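(* Let $k$ be an algebraically closed field of characteristic zero. Let $2\le n<m$ be positive integers such that $m,n$ are not relatively prime and $n$ does not divide $m$. Let $R=k[[x,y]]:=\frac{k[[X,Y]]}{(f)}$ be an irreducible plane algebroid curve with parametric representation $$x=t^n,\qquad y=t^m+bt^{m+1}+\text{(terms of degree higher than }m+1),$$ where $b\in k$ is a nonzero constant. If $a(t)\in\overline R=k[[t]]$ is a nonzero power series such that $a(t)\frac{d}{dt}$ induces a derivation of $R$, then the $t$-order of $a(t)$ is at least $n+2$.
   Context: An irreducible plane algebroid curve over $k$ is a quotient ring $R=k[[X,Y]]/(f)$ with $f\in k[[X,Y]]$ an irreducible power series; $x,y$ denote the residue classes of $X,Y$. The integral closure $\overline R$ of $R$ in its field of fractions is isomorphic to $k[[t]]$, and $R$ is regarded as a subring of $k[[t]]$. Saying that $R$ has parametric representation $x=x(t)$, $y=y(t)$ means that, under such an identification, $R=k[[x(t),y(t)]]\subseteq k[[t]]=\overline R$; in particular $k[[t]]$ is the integral closure of $k[[x(t),y(t)]]$ in its field of fractions. For nonzero $a\in k[[t]]$, its $t$-order is the smallest power of $t$ appearing in $a$ with nonzero coefficient. One says $a(t)\frac{d}{dt}$ induces a derivation of $R$ if $a(t)\frac{dr}{dt}\in R$ for all $r\in R$. *)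

theory Defs
  imports "HOL-Computational_Algebra.Computational_Algebra"
begin

(* The ring k[[X,Y]] is the type 'a fps fps: the power series F stands for
   sum_j F_j(X) Y^j with F_j = fps_nth F j, so the inner variable is X
   and the outer variable is Y.

   ps_subst2 F x y is F(x(t), y(t)) = sum_j F_j(x(t)) y(t)^j, read off coefficientwise.
   It is meaningful only if x and y have zero constant term; then y^j has order at least j,
   so only the terms with j <= d contribute to the coefficient of t^d. *)
definition ps_subst2 :: "'a::comm_ring_1 fps fps \<Rightarrow> 'a fps \<Rightarrow> 'a fps \<Rightarrow> 'a fps" where
  "ps_subst2 F x y = Abs_fps (\<lambda>d. \<Sum>j\<le>d. fps_nth (fps_compose (fps_nth F j) x * y ^ j) d)"

(* The subring k[[x(t), y(t)]] of k[[t]]. *)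
definition param_ring :: "'a::comm_ring_1 fps \<Rightarrow> 'a fps \<Rightarrow> 'a fps set" where
  "param_ring x y = range (\<lambda>F. ps_subst2 F x y)"

definition integral_over :: "'b::comm_ring_1 set \<Rightarrow> 'b \<Rightarrow> bool" where
  "integral_over A z \<longleftrightarrow>
     (\<exists>p. lead_coeff p = 1 \<and> (\<forall>i. coeff p i \<in> A) \<and> poly p z = 0)"

(* Field of fractions of a subring A of a field, formed inside that field. *)
definition fractions_of :: "'b::field set \<Rightarrow> 'b set" where
  "fractions_of A = {u / v | u v. u \<in> A \<and> v \<in> A \<and> v \<noteq> 0}"

definition integral_closure :: "'b::field set \<Rightarrow> 'b set" where
  "integral_closure A = {z \<in> fractions_of A. integral_over A z}"

(* The curve R = k[[X,Y]]/(f) has parametric representation x = x(t), y = y(t):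
   X \<mapsto> x(t), Y \<mapsto> y(t) is a substitution k[[X,Y]] -> k[[t]] with kernel the ideal (f),
   so that it identifies k[[X,Y]]/(f) with its image k[[x(t), y(t)]], and k[[t]] is the
   integral closure of this image in its field of fractions (taken inside k((t))). *)
definition parametric_representation ::
    "'a::field fps fps \<Rightarrow> 'a fps \<Rightarrow> 'a fps \<Rightarrow> bool" where
  "parametric_representation f x y \<longleftrightarrow>
     fps_nth x 0 = 0 \<and> fps_nth y 0 = 0 \<and>
     {F. ps_subst2 F x y = 0} = {F. f dvd F} \<and>
     integral_closure (fps_to_fls ` param_ring x y) = range fps_to_fls"

(* a(t) d/dt induces a derivation of the subring R of k[[t]]. *)
definition induces_derivation :: "'a::comm_ring_1 fps \<Rightarrow> 'a fps set \<Rightarrow> bool" where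
  "induces_derivation a R \<longleftrightarrow> (\<forall>r\<in>R. a * fps_deriv r \<in> R)"

end

theory Submission
  imports Defs
begin

text \<open>
  Put $x = t^n$ and $R = k[[x,y]]$, and let $m$ and $n$ have a common divisor $p > 1$, so that
  $m \<ge> n + 2$. In $r = F_0(x) + F_1(x)\,y + F_2(x)\,y^2 + \ldots$ the terms from $y^2$ on have
  order at least $2m \<ge> m + n + 2$, and of the middle term only $y$ and $xy$ reach below degree
  $m + n + 2$. Since $F_0(x)$ lives in degrees divisible by $n$, the coefficients of $r$ in the
  other degrees are rigidly tied to each other: those below degree $m+n$ are $r_m$ times those of
  $y$ (\<open>param_ring_nth\<close>), and if $r_m = 0$ then $r_{m+n+1} = b\,r_{m+n}$
  (\<open>param_ring_nth_Suc\<close>).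

  Let $a$ have order $s \<le> n+1$ and leading coefficient $c$. Then $h = a x' = n t^{n-1} a$ lies in
  $R$ and has order $e = s+n-1 \<le> 2n$, which by rigidity must be $n$, $2n$ or $m$. Rigidity of $h$
  also determines the second coefficient of $a$: it is $0$ for $e = n, 2n$, and $bc$ for $e = m$.
  This gives the two leading terms of $r = a y' \<in> R$, in degrees $s+m-1$ and $s+m$.

  For $e = n$ and $e = 2n$ these two coefficients are $mc$ and $(m+1)bc$, while rigidity of $r$ in
  degrees $m, m+1$ (respectively $m+n, m+n+1$) forces their quotient to be $b$; so $bc = 0$. For
  $e = m$ the second coefficient is $(2m+1)bc$ in degree $2m-n+1$, which is not divisible by $n$
  because $p$ divides $2m - n$; it lies strictly between $m$ and $m+n$, and $r_m = 0$, so rigidity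
  makes it vanish. In characteristic zero each case contradicts $b, c \<noteq> 0$. The
  underlying reason is that $d/dt$ multiplies the terms $t^m$ and $bt^{m+1}$ of $y$ by the different
  factors $m$ and $m+1$, which disturbs the ratio $b$ that the ring prescribes.
\<close>

section \<open>Low-order coefficients in the ring of the curve\<close>

lemma ps_subst2_const: "ps_subst2 (fps_const g) x y = fps_compose g x"
proof (rule fps_ext)
  fix d
  have "(\<Sum>j\<le>d. fps_nth (fps_compose (fps_nth (fps_const g) j) x * y ^ j) d)
      = (\<Sum>j\<in>{0}. fps_nth (fps_compose (fps_nth (fps_const g) j) x * y ^ j) d)"
    by (rule sum.mono_neutral_right) auto
  then show "fps_nth (ps_subst2 (fps_const g) x y) d = fps_nth (fps_compose g x) d"
    by (simp add: ps_subst2_def)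
qed

lemma x_in_param_ring:
  fixes x y :: "'a::comm_ring_1 fps"
  assumes "fps_nth x 0 = 0"
  shows "x \<in> param_ring x y"
proof -
  have "ps_subst2 (fps_const fps_X) x y = x"
    using assms by (simp add: ps_subst2_const fps_X_fps_compose_startby0)
  then show ?thesis
    unfolding param_ring_def by (metis rangeI)
qed

lemma y_in_param_ring:
  fixes x y :: "'a::comm_ring_1 fps"
  assumes "fps_nth y 0 = 0"
  shows "y \<in> param_ring x y"
proof -
  have "ps_subst2 fps_X x y = y"
  proof (rule fps_ext)
    fix d
    have "(\<Sum>j\<le>d. fps_nth (fps_compose (fps_nth fps_X j) x * y ^ j) d)
        = (\<Sum>j\<le>d. if j = 1 then fps_nth y d else 0)"
      by (rule sum.cong) (auto simp: fps_X_def)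
    then show "fps_nth (ps_subst2 fps_X x y) d = fps_nth y d"
      using assms by (cases d) (auto simp: ps_subst2_def)
  qed
  then show ?thesis
    unfolding param_ring_def by (metis rangeI)
qed

text \<open>
  In degrees up to $m+n+1$ an element of the ring agrees with $g + uy + vxy$, where $g$ is a power
  series in $x = t^n$: the monomials $x^2y$ and $y^2$ have orders $m+2n$ and $2m$, both at least
  $m+n+2$.
\<close>

lemma param_ring_low_order:
  fixes y r :: "'a::comm_ring_1 fps"
  assumes n: "2 \<le> n" and nm: "n + 2 \<le> m"
    and y: "\<forall>i<m. fps_nth y i = 0"
    and r: "r \<in> param_ring (fps_X ^ n) y"
  obtains g u v where
    "\<And>i. \<not> n dvd i \<Longrightarrow> fps_nth g i = 0"
    "\<And>i. i \<le> m + n + 1 \<Longrightarrow>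
       fps_nth r i = fps_nth g i + u * fps_nth y i + v * fps_nth (fps_X ^ n * y) i"
proof -
  obtain F where F: "r = ps_subst2 F (fps_X ^ n) y"
    using r by (auto simp: param_ring_def)
  define G where "G j = fps_compose (fps_nth F j) (fps_X ^ n)" for j
  have G: "fps_nth (G j) i = (if n dvd i then fps_nth (fps_nth F j) (i div n) else 0)" for i j
    using n by (simp add: G_def fps_nth_compose_X_power)
  have coeff: "fps_nth r i = fps_nth (G 0) i + fps_nth (G 1) 0 * fps_nth y i
      + fps_nth (G 1) n * fps_nth (fps_X ^ n * y) i" if i: "i \<le> m + n + 1" for i
  proof -
    have y_power: "fps_nth (G j * y ^ j) i = 0" if j: "2 \<le> j" for j
    proof -
      have "y = fps_X ^ m * fps_shift m y"
        using y by (intro fps_ext) (auto simp: fps_X_power_mult_nth)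
      then have "y ^ j = fps_X ^ (m * j) * fps_shift m y ^ j"
        by (metis power_mult power_mult_distrib)
      then have "G j * y ^ j = fps_X ^ (m * j) * (G j * fps_shift m y ^ j)"
        by (simp add: mult.left_commute)
      moreover have "i < m * j"
      proof -
        have "m * 2 \<le> m * j" using j by (rule mult_le_mono2)
        then show ?thesis using i nm by linarith
      qed
      ultimately show ?thesis
        by (simp add: fps_X_power_mult_nth)
    qed
    have y_linear: "fps_nth (G 1 * y) i =
        fps_nth (G 1) 0 * fps_nth y i + fps_nth (G 1) n * fps_nth (fps_X ^ n * y) i"
    proof -
      have vanish: "fps_nth (G 1) k * fps_nth y (i - k) = 0" if "k \<notin> {0, n}" for k
      proof (cases "n dvd k")
        case True
        then obtain l where "k = n * l" by (elim dvdE)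
        with that have "l \<noteq> 0" "l \<noteq> 1" by auto
        then have "2 \<le> l" by linarith
        then have "n * 2 \<le> k" using \<open>k = n * l\<close> by simp
        then have "i - k < m" using i n nm by linarith
        then show ?thesis using y by simp
      qed (simp add: G)
      have "fps_nth (G 1 * y) i = (\<Sum>k=0..i. fps_nth (G 1) k * fps_nth y (i - k))"
        by (simp add: fps_mult_nth)
      also have "\<dots> = (\<Sum>k\<in>{0..i} \<inter> {0, n}. fps_nth (G 1) k * fps_nth y (i - k))"
        by (rule sum.mono_neutral_right) (use vanish in auto)
      also have "\<dots> = fps_nth (G 1) 0 * fps_nth y i + fps_nth (G 1) n * fps_nth (fps_X ^ n * y) i"
      proof (cases "n \<le> i")
        case True
        then have "{0..i} \<inter> {0, n} = {0, n}" by auto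
        then show ?thesis using True n by (simp add: fps_X_power_mult_nth)
      next
        case False
        then have "{0..i} \<inter> {0, n} = {0}" by auto
        then show ?thesis using False by (simp add: fps_X_power_mult_nth)
      qed
      finally show ?thesis .
    qed
    have r_nth: "fps_nth r i = (\<Sum>j\<le>i. fps_nth (G j * y ^ j) i)"
      by (simp add: F ps_subst2_def G_def)
    show ?thesis
    proof (cases i)
      case 0
      then show ?thesis using r_nth y n nm by (simp add: fps_X_power_mult_nth)
    next
      case (Suc i')
      have "fps_nth r i = (\<Sum>j\<in>{0, 1}. fps_nth (G j * y ^ j) i)"
        unfolding r_nth
        by (rule sum.mono_neutral_right) (use Suc y_power in auto)
      then show ?thesis using y_linear by simp
    qed
  qed
  show ?thesis
    by (rule that[OF _ coeff]) (auto simp: G)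
qed

text \<open>
  In these degrees neither $g$ nor $xy$ contributes, and comparing degree $m$ identifies the
  coefficient $u$ of $y$ as $r_m$.
\<close>

lemma param_ring_nth:
  fixes y r :: "'a::comm_ring_1 fps"
  assumes n: "2 \<le> n" and nm: "n + 2 \<le> m" and ndvd: "\<not> n dvd m"
    and y: "\<forall>i<m. fps_nth y i = 0" "fps_nth y m = 1"
    and r: "r \<in> param_ring (fps_X ^ n) y"
    and i: "i < m + n" "\<not> n dvd i"
  shows "fps_nth r i = fps_nth r m * fps_nth y i"
proof -
  obtain g u v where g: "\<And>i. \<not> n dvd i \<Longrightarrow> fps_nth g i = 0"
    and expand: "\<And>i. i \<le> m + n + 1 \<Longrightarrow>
       fps_nth r i = fps_nth g i + u * fps_nth y i + v * fps_nth (fps_X ^ n * y) i"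
    using param_ring_low_order[OF n nm y(1) r] by blast
  have xy: "fps_nth (fps_X ^ n * y) j = 0" if "j < m + n" for j
    using that y by (auto simp: fps_X_power_mult_nth)
  have "fps_nth r m = u"
    using expand[of m] g[OF ndvd] xy[of m] y n by simp
  then show ?thesis
    using expand[of i] g[OF i(2)] xy[OF i(1)] i by simp
qed

text \<open>
  If $r_m = 0$, then $r$ agrees with $g + vxy$ in degrees up to $m+n+1$, so the leading terms of
  $xy$ are visible in degrees $m+n$ and $m+n+1$.
\<close>

lemma param_ring_nth_Suc:
  fixes y r :: "'a::comm_ring_1 fps"
  assumes n: "2 \<le> n" and nm: "n + 2 \<le> m" and ndvd: "\<not> n dvd m" "\<not> n dvd m + 1"
    and y: "\<forall>i<m. fps_nth y i = 0" "fps_nth y m = 1"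
    and r: "r \<in> param_ring (fps_X ^ n) y" and rm: "fps_nth r m = 0"
  shows "fps_nth r (m + n + 1) = fps_nth r (m + n) * fps_nth y (m + 1)"
proof -
  obtain g u v where g: "\<And>i. \<not> n dvd i \<Longrightarrow> fps_nth g i = 0"
    and expand: "\<And>i. i \<le> m + n + 1 \<Longrightarrow>
       fps_nth r i = fps_nth g i + u * fps_nth y i + v * fps_nth (fps_X ^ n * y) i"
    using param_ring_low_order[OF n nm y(1) r] by blast
  have "u = 0"
    using expand[of m] g[OF ndvd(1)] y n nm rm by (simp add: fps_X_power_mult_nth)
  have "\<not> n dvd m + n"
    using ndvd(1) by simp
  then have 1: "fps_nth r (m + n) = v"
    using expand[of "m + n"] g y \<open>u = 0\<close> by (simp add: fps_X_power_mult_nth)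
  have "\<not> n dvd m + n + 1"
    using ndvd(2) by (metis add.assoc add.commute dvd_add_triv_right_iff)
  then have 2: "fps_nth r (m + n + 1) = v * fps_nth y (m + 1)"
    using expand[of "m + n + 1"] g \<open>u = 0\<close> by (simp add: fps_X_power_mult_nth)
  show ?thesis
    using 1 2 by simp
qed

section \<open>The bound on the order\<close>

lemma fps_mult_leading_terms:
  fixes u w :: "'a::comm_ring_1 fps"
  assumes u: "\<forall>i<p. fps_nth u i = 0" and w: "\<forall>i<q. fps_nth w i = 0"
  shows "\<forall>i<p + q. fps_nth (u * w) i = 0"
    and "fps_nth (u * w) (p + q) = fps_nth u p * fps_nth w q"
    and "fps_nth (u * w) (p + q + 1) =
           fps_nth u p * fps_nth w (q + 1) + fps_nth u (p + 1) * fps_nth w q"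
proof -
  have "u = fps_X ^ p * fps_shift p u" "w = fps_X ^ q * fps_shift q w"
    using u w by (auto intro!: fps_ext simp: fps_X_power_mult_nth)
  then have uw: "u * w = fps_X ^ (p + q) * (fps_shift p u * fps_shift q w)"
    by (metis (no_types, lifting) mult.assoc mult.left_commute power_add)
  show "\<forall>i<p + q. fps_nth (u * w) i = 0"
    unfolding uw by (simp add: fps_X_power_mult_nth)
  show "fps_nth (u * w) (p + q) = fps_nth u p * fps_nth w q"
    unfolding uw by (simp add: fps_X_power_mult_nth)
  show "fps_nth (u * w) (p + q + 1) =
          fps_nth u p * fps_nth w (q + 1) + fps_nth u (p + 1) * fps_nth w q"
  proof -
    have "fps_nth (u * w) (p + q + 1) = fps_nth (fps_shift p u * fps_shift q w) 1"
      unfolding uw by (simp add: fps_X_power_mult_nth)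
    also have "\<dots> = fps_nth u p * fps_nth w (q + 1) + fps_nth u (p + 1) * fps_nth w q"
      by (simp add: fps_mult_nth)
    finally show ?thesis .
  qed
qed

theorem proposition4p4:
  fixes f :: "'a::{alg_closed_field, field_char_0} fps fps"
    and x y a :: "'a fps"
    and b :: 'a
    and n m :: nat
  assumes "2 \<le> n" and "n < m"
    and "\<not> coprime m n" and "\<not> n dvd m"
    and "irreducible f"
    and "parametric_representation f x y"
    and "x = fps_X ^ n"
    and "\<forall>i<m. fps_nth y i = 0" and "fps_nth y m = 1"
    and "fps_nth y (m + 1) = b" and "b \<noteq> 0"
    and "a \<noteq> 0"
    and "induces_derivation a (param_ring x y)"
  shows "n + 2 \<le> subdegree a"
proof (rule ccontr)
  assume "\<not> n + 2 \<le> subdegree a"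
  define s where "s = subdegree a"
  define c where "c = fps_nth a s"
  have s: "s \<le> n + 1" using \<open>\<not> n + 2 \<le> subdegree a\<close> by (simp add: s_def)
  have c: "c \<noteq> 0" using \<open>a \<noteq> 0\<close> by (simp add: c_def s_def)
  have a_below: "\<forall>i<s. fps_nth a i = 0"
    unfolding s_def by (blast intro: nth_less_subdegree_zero)

  obtain p where p: "p dvd m" "p dvd n" "\<not> p dvd 1"
    using \<open>\<not> coprime m n\<close> unfolding coprime_def by blast
  have p_Suc: "\<not> p dvd k + 1" if "p dvd k" for k
    using p(3) dvd_add_right_iff[OF that] by blast
  \<comment> \<open>This puts the degrees right after multiples of $p$ out of reach of power series in $x$.\<close>
  have n_Suc: "\<not> n dvd k + 1" if "p dvd k" for k
    using p_Suc[OF that] p(2) dvd_trans by blast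
  have "m \<noteq> n + 1" using p_Suc[OF p(2)] p(1) by auto
  then have nm: "n + 2 \<le> m" using \<open>n < m\<close> by linarith
  note rigid = param_ring_nth[OF \<open>2 \<le> n\<close> nm \<open>\<not> n dvd m\<close>
      \<open>\<forall>i<m. fps_nth y i = 0\<close> \<open>fps_nth y m = 1\<close>]
  note y_below = \<open>\<forall>i<m. fps_nth y i = 0\<close>

  define h where "h = a * fps_deriv x"
  define r where "r = a * fps_deriv y"
  have hR: "h \<in> param_ring (fps_X ^ n) y"
    using assms(1,7,13) x_in_param_ring[of x y]
    by (simp add: h_def induces_derivation_def)
  have "fps_nth y 0 = 0" using y_below \<open>n < m\<close> by simp
  then have rR: "r \<in> param_ring (fps_X ^ n) y"
    using assms(7,13) y_in_param_ring[of y x]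
    by (simp add: r_def induces_derivation_def)

  define e where "e = s + (n - 1)"
  have x': "\<forall>i<n-1. fps_nth (fps_deriv x) i = 0" "fps_nth (fps_deriv x) (n - 1) = of_nat n"
      "fps_nth (fps_deriv x) (n - 1 + 1) = 0"
    using \<open>2 \<le> n\<close> by (auto simp: \<open>x = fps_X ^ n\<close>)
  have h_below: "\<forall>i<e. fps_nth h i = 0" and h_e: "fps_nth h e = of_nat n * c"
    and h_Suc_e: "fps_nth h (e + 1) = of_nat n * fps_nth a (s + 1)"
    using fps_mult_leading_terms[OF a_below x'(1)] x'(2,3)
    by (simp_all add: h_def e_def c_def mult.commute)
  have h_e_nz: "fps_nth h e \<noteq> 0" using h_e c \<open>2 \<le> n\<close> by simp

  have m1: "m - 1 + 1 = m" using \<open>n < m\<close> by linarith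
  have y': "\<forall>i<m-1. fps_nth (fps_deriv y) i = 0" "fps_nth (fps_deriv y) (m - 1) = of_nat m"
      "fps_nth (fps_deriv y) (m - 1 + 1) = of_nat (m + 1) * b"
    using y_below assms(9,10) m1 by (simp_all add: fps_deriv_nth)
  have r_below: "\<forall>i<s + (m - 1). fps_nth r i = 0"
    and r_lead: "fps_nth r (s + (m - 1)) = of_nat m * c"
    and r_next: "fps_nth r (s + (m - 1) + 1) =
        of_nat (m + 1) * b * c + of_nat m * fps_nth a (s + 1)"
    using fps_mult_leading_terms[OF a_below y'(1)]
    unfolding r_def y'(2,3) c_def by (simp_all add: mult_ac)

  have e: "1 \<le> e" "e \<le> 2 * n" using s \<open>2 \<le> n\<close> by (auto simp: e_def)
  \<comment> \<open>In degrees below $m+n$, which include all degrees up to $2n$, only $y$ itself can start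
    outside the multiples of $n$.\<close>
  have "n dvd e" if "e \<noteq> m"
  proof (rule ccontr)
    assume "\<not> n dvd e"
    with e nm have "fps_nth h e = fps_nth h m * fps_nth y e"
      by (intro rigid[OF hR]) auto
    moreover have "fps_nth h m * fps_nth y e = 0"
      using h_below y_below that by (cases "e < m") auto
    ultimately show False using h_e_nz by simp
  qed
  then consider "e = m" | "e = n" | "e = 2 * n"
  proof (cases "e = m")
    case False
    with \<open>e \<noteq> m \<Longrightarrow> n dvd e\<close> obtain l where l: "e = n * l" by (auto elim: dvdE)
    then have "l \<le> 2" "1 \<le> l" using e \<open>2 \<le> n\<close> by (auto simp: mult.commute)
    then have "l = 1 \<or> l = 2" by linarith
    then show ?thesis using l that by (auto simp: mult.commute)
  qed
  then show False
  proof cases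
    case 1
    \<comment> \<open>Here $e = m \<le> 2n$, and $p$ divides $2n - m \<noteq> 0$; the resulting gap of $2$ keeps the
      degree $2m - n + 1$ below $m + n$.\<close>
    have "m \<noteq> 2 * n" using \<open>\<not> n dvd m\<close> by auto
    moreover have "m + 1 \<noteq> 2 * n" using p_Suc[OF p(1)] p(2) by (metis dvd_mult)
    ultimately have m: "m + 2 \<le> 2 * n" using 1 e by linarith
    have lead: "s + (m - 1) + n = 2 * m" using 1 \<open>2 \<le> n\<close> nm by (simp add: e_def)
    have "fps_nth h (m + 1) = fps_nth h m * fps_nth y (m + 1)"
      using \<open>2 \<le> n\<close> n_Suc[OF p(1)] by (intro rigid[OF hR]) auto
    then have "of_nat n * fps_nth a (s + 1) = of_nat n * (c * b)"
      using 1 h_e h_Suc_e assms(10) by (auto simp: mult_ac)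
    then have "fps_nth a (s + 1) = c * b" using \<open>2 \<le> n\<close> by simp
    then have "fps_nth r (s + (m - 1) + 1) = of_nat (2 * m + 1) * (b * c)"
      using r_next by (simp add: algebra_simps)
    moreover have "fps_nth r (s + (m - 1) + 1) = fps_nth r m * fps_nth y (s + (m - 1) + 1)"
    proof (rule rigid[OF rR])
      show "s + (m - 1) + 1 < m + n" using lead m by linarith
      have "p dvd s + (m - 1)" using lead p(1,2) by (metis dvd_add_left_iff dvd_mult)
      then show "\<not> n dvd s + (m - 1) + 1" by (rule n_Suc)
    qed
    moreover have "m < s + (m - 1)" using lead \<open>n < m\<close> by linarith
    then have "fps_nth r m = 0" using r_below by blast
    ultimately have "of_nat (2 * m + 1) * (b * c) = 0" by (simp only: mult_zero_left)
    then show False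
      using \<open>b \<noteq> 0\<close> c by (simp only: mult_eq_0_iff of_nat_eq_0_iff) simp
  next
    case 2
    then have "s = 1" using \<open>2 \<le> n\<close> by (simp add: e_def)
    have "fps_nth h (n + 1) = fps_nth h m * fps_nth y (n + 1)"
      using nm n_Suc[OF p(2)] by (intro rigid[OF hR]) auto
    then have "fps_nth a (s + 1) = 0"
      using h_Suc_e 2 y_below nm \<open>2 \<le> n\<close> by simp
    then have "fps_nth r m = of_nat m * c" "fps_nth r (m + 1) = of_nat (m + 1) * b * c"
      using r_lead r_next \<open>s = 1\<close> m1 by (simp_all add: add.commute)
    moreover have "fps_nth r (m + 1) = fps_nth r m * fps_nth y (m + 1)"
      using \<open>2 \<le> n\<close> n_Suc[OF p(1)] by (intro rigid[OF rR]) auto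
    ultimately have "b * c = 0" using assms(10) by (simp add: algebra_simps)
    then show False using \<open>b \<noteq> 0\<close> c by simp
  next
    case 3
    then have "s = n + 1" using \<open>2 \<le> n\<close> by (simp add: e_def)
    then have lead: "s + (m - 1) = m + n" using m1 by linarith
    have "p dvd 2 * n" using p(2) by simp
    have "fps_nth h (2 * n + 1) = fps_nth h m * fps_nth y (2 * n + 1)"
      using nm n_Suc[OF \<open>p dvd 2 * n\<close>] by (intro rigid[OF hR]) auto
    \<comment> \<open>Either $m < 2n = e$, and $h$ has no term in degree $m$, or $m > 2n + 1$, and $y$ has none
      in degree $2n + 1$.\<close>
    moreover have "fps_nth h m * fps_nth y (2 * n + 1) = 0"
    proof (cases "m < 2 * n")
      case True
      then show ?thesis using h_below 3 by simp
    next
      case False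
      moreover have "m \<noteq> 2 * n" using \<open>\<not> n dvd m\<close> by auto
      moreover have "m \<noteq> 2 * n + 1" using p_Suc[OF \<open>p dvd 2 * n\<close>] p(1) by auto
      ultimately have "2 * n + 1 < m" by linarith
      then show ?thesis using y_below by simp
    qed
    ultimately have "fps_nth a (s + 1) = 0"
      using h_Suc_e 3 \<open>2 \<le> n\<close> by auto
    then have "fps_nth r (m + n) = of_nat m * c"
      "fps_nth r (m + n + 1) = of_nat (m + 1) * b * c"
      using r_lead r_next unfolding lead by simp_all
    moreover have "fps_nth r m = 0" using r_below \<open>2 \<le> n\<close> unfolding lead by simp
    then have "fps_nth r (m + n + 1) = fps_nth r (m + n) * fps_nth y (m + 1)"
      by (intro param_ring_nth_Suc[OF \<open>2 \<le> n\<close> nm \<open>\<not> n dvd m\<close> n_Suc[OF p(1)]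
            y_below \<open>fps_nth y m = 1\<close> rR])
    ultimately have "b * c = 0" using assms(10) by (simp add: algebra_simps)
    then show False using \<open>b \<noteq> 0\<close> c by simp
  qed
qed

end
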